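(* Let $\mathcal{S}$ be a separable Banach lattice, $p\ge1$, and $\psi_p(z)=1+\|z\|^p$. Suppose a total preorder $\succeq$ on $\mathcal{P}^{\psi_p}(\mathcal{S})$ is continuous (in the $\psi_p$-weak topology), risk-averse, and satisfies the independence axiom. Then there exists a concave function $u\in C_b^{\psi_p}(\mathcal{S})$ such that $U(\mu)=\int_{\mathcal{S}}u(z)\,\mu(dz)$ is a numerical representation of $\succeq$ on $\mathcal{P}^{\psi_p}(\mathcal{S})$.
   Context: $C_b^{\psi}(\mathcal{S})=\{f : f/\psi \text{ bounded continuous}\}$; $\mathcal{M}^\psi(\mathcal{S})$ is the space of regular signed Borel measures $\mu$ with $|\int f\,d\mu|<\infty$ for all $f\in C_b^\psi$; $\mathcal{P}^\psi(\mathcal{S})$ its probability measures; $\psi$-weak convergence means convergence of $\int f\,d\mu_n$ for all $f\in C_b^\psi$. For $\mu\in\mathcal{P}^{\psi_p}(\mathcal{S})$ and a $\sigma$-subalgebra $\mathcal{G}$ of the Borel $\sigma$-algebra $\mathcal{B}$, the conditional expectation $\mathcal{E}_{\mu|\mathcal{G}}:\mathcal{S}\to\mathcal{S}$ is a $\mathcal{G}$-measurable map with $\int_G\mathcal{E}_{\mu|\mathcal{G}}(z)\,\mu(dz)=\int_G z\,\mu(dz)$ for all $G\in\mathcal{G}$ (Bochner integrals), and $\mu_{\mathcal{G}}(A)=\mu(\mathcal{E}_{\mu|\mathcal{G}}^{-1}(A))$, $A\in\mathcal{B}$. The preorder is risk-averse if $\mu_{\mathcal{G}}\succeq\mu$ for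 all $\mu\in\mathcal{P}^{\psi_p}(\mathcal{S})$ and all $\sigma$-subalgebras $\mathcal{G}$. Total preorder, continuity (closed upper and lower contour sets), numerical representation ($z\succ v\iff U(z)>U(v)$), and the independence axiom ($\mu\succ\nu\Rightarrow\alpha\mu+(1-\alpha)\lambda\succ\alpha\nu+(1-\alpha)\lambda$, $\alpha\in(0,1)$) are as usual. *)

theory Defs
  imports "HOL-Probability.Probability"
begin

class banach_lattice = banach + lattice +
  assumes bl_add_mono: "x \<le> y \<Longrightarrow> x + z \<le> y + z"
      and bl_scaleR_nonneg: "0 \<le> x \<Longrightarrow> 0 \<le> c \<Longrightarrow> 0 \<le> c *\<^sub>R x"
      and bl_norm_mono: "sup x (- x) \<le> sup y (- y) \<Longrightarrow> norm x \<le> norm y"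

definition psi :: "real \<Rightarrow> 'a::real_normed_vector \<Rightarrow> real" where
  "psi p z = 1 + norm z powr p"

definition Cb_psi :: "('a::real_normed_vector \<Rightarrow> real) \<Rightarrow> ('a \<Rightarrow> real) set" where
  "Cb_psi w = {f. continuous_on UNIV f \<and> bounded (range (\<lambda>z. f z / w z))}"

text \<open>P^psi_p: Borel probability measures integrating psi_p
  (Borel measures on a separable Banach space are automatically regular).\<close>
definition P_psi :: "real \<Rightarrow> 'a::real_normed_vector measure set" where
  "P_psi p = {M. sets M = sets borel \<and> prob_space M \<and> integrable M (\<lambda>z. norm z powr p)}"

definition psi_weak_topology :: "real \<Rightarrow> 'a::real_normed_vector measure topology" where
  "psi_weak_topology p =
     subtopology
       (topology_generated_by
          {{M \<in> P_psi p. integral\<^sup>L M f \<in> V} | f V. f \<in> Cb_psi (psi p) \<and> open V})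
       (P_psi p)"

definition total_preorder_on :: "'b set \<Rightarrow> ('b \<Rightarrow> 'b \<Rightarrow> bool) \<Rightarrow> bool" where
  "total_preorder_on A R \<longleftrightarrow>
     (\<forall>x\<in>A. R x x) \<and>
     (\<forall>x\<in>A. \<forall>y\<in>A. \<forall>z\<in>A. R x y \<longrightarrow> R y z \<longrightarrow> R x z) \<and>
     (\<forall>x\<in>A. \<forall>y\<in>A. R x y \<or> R y x)"

definition strict :: "('b \<Rightarrow> 'b \<Rightarrow> bool) \<Rightarrow> 'b \<Rightarrow> 'b \<Rightarrow> bool" where
  "strict R x y \<longleftrightarrow> R x y \<and> \<not> R y x"

definition pref_continuous :: "real \<Rightarrow> ('a::real_normed_vector measure \<Rightarrow> 'a measure \<Rightarrow> bool) \<Rightarrow> bool" where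
  "pref_continuous p R \<longleftrightarrow>
     (\<forall>\<mu>\<in>P_psi p. closedin (psi_weak_topology p) {\<nu> \<in> P_psi p. R \<nu> \<mu>} \<and>
                   closedin (psi_weak_topology p) {\<nu> \<in> P_psi p. R \<mu> \<nu>})"

definition mix :: "real \<Rightarrow> 'a::topological_space measure \<Rightarrow> 'a measure \<Rightarrow> 'a measure" where
  "mix \<alpha> \<mu> \<nu> = measure_of UNIV (sets borel)
      (\<lambda>A. ennreal \<alpha> * emeasure \<mu> A + ennreal (1 - \<alpha>) * emeasure \<nu> A)"

definition independence_axiom :: "real \<Rightarrow> ('a::real_normed_vector measure \<Rightarrow> 'a measure \<Rightarrow> bool) \<Rightarrow> bool" where
  "independence_axiom p R \<longleftrightarrow>
     (\<forall>\<mu>\<in>P_psi p. \<forall>\<nu>\<in>P_psi p. \<forall>\<eta>\<in>P_psi p. \<forall>\<alpha>::real. 0 < \<alpha> \<and> \<alpha> < 1 \<longrightarrow>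
        strict R \<mu> \<nu> \<longrightarrow> strict R (mix \<alpha> \<mu> \<eta>) (mix \<alpha> \<nu> \<eta>))"

definition is_cond_exp :: "'a::{banach, second_countable_topology} measure \<Rightarrow> 'a set set \<Rightarrow> ('a \<Rightarrow> 'a) \<Rightarrow> bool" where
  "is_cond_exp \<mu> G E \<longleftrightarrow>
     E \<in> measurable (sigma UNIV G) borel \<and> integrable \<mu> E \<and>
     (\<forall>A\<in>G. set_lebesgue_integral \<mu> A E = set_lebesgue_integral \<mu> A (\<lambda>z. z))"

definition risk_averse :: "real \<Rightarrow> ('a::{banach, second_countable_topology} measure \<Rightarrow> 'a measure \<Rightarrow> bool) \<Rightarrow> bool" where
  "risk_averse p R \<longleftrightarrow>
     (\<forall>\<mu>\<in>P_psi p. \<forall>G. sigma_algebra UNIV G \<and> G \<subseteq> sets borel \<longrightarrow>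
        (\<forall>E. is_cond_exp \<mu> G E \<longrightarrow> R (distr \<mu> borel E) \<mu>))"

end

theory Submission
  imports Defs
begin

text \<open>The preorder is a continuous preference on a mixture set, so calibration against a fixed pair
  of lotteries \<open>a \<succ> b\<close> yields an affine utility \<open>U\<close>, as in the theorem of Herstein and Milnor. Since
  the range of \<open>U\<close> is an interval, closed contour sets make \<open>U\<close> sequentially \<open>\<psi>\<close>-weakly continuous.
  Put \<open>u z = U \<delta>\<^sub>z\<close>. Continuity of \<open>U\<close> along Dirac measures and along mixtures of
  \<open>\<delta>\<^sub>0\<close> with vanishing mass far away gives \<open>u \<in> C\<^sub>b\<^sup>\<psi>\<close>; pushing \<open>\<mu>\<close> forward along simple functions
  that approximate the identity gives \<open>U \<mu> = \<integral>u d\<mu>\<close>; risk aversion for the trivial \<open>\<sigma>\<close>-algebra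
  gives concavity.\<close>

section \<open>Mixture sets\<close>

lemma convex_comb_bounds:
  fixes a s t :: real
  assumes "0 \<le> a" "a \<le> 1" "0 \<le> s" "s \<le> 1" "0 \<le> t" "t \<le> 1"
  shows "0 \<le> a * s + (1 - a) * t" "a * s + (1 - a) * t \<le> 1"
  using assms convex_bound_le[of s 1 t a "1 - a"] by auto

text \<open>Lets a mixing weight tend to 0 once a preference is known for all weights strictly
  between 0 and 1.\<close>

lemma closed_unit_zero_mem:
  fixes C :: "real set"
  assumes "closed C" "{0<..<1} \<subseteq> C"
  shows "0 \<in> C"
  using closure_minimal[OF assms(2,1)] by auto

text \<open>The evaluations \<open>ev\<close> separate the points of \<open>A\<close> and turn mixtures into convex combinations
  of reals, so that every mixture identity becomes an identity in real arithmetic.\<close>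

locale mixture_preference =
  fixes A :: "'b set" and m :: "real \<Rightarrow> 'b \<Rightarrow> 'b \<Rightarrow> 'b" and ev :: "'i \<Rightarrow> 'b \<Rightarrow> real"
    and R :: "'b \<Rightarrow> 'b \<Rightarrow> bool"
  assumes m_closed [simp]: "\<lbrakk>x \<in> A; y \<in> A; 0 \<le> a; a \<le> 1\<rbrakk> \<Longrightarrow> m a x y \<in> A"
    and ev_m: "\<lbrakk>x \<in> A; y \<in> A; 0 \<le> a; a \<le> 1\<rbrakk> \<Longrightarrow> ev i (m a x y) = a * ev i x + (1 - a) * ev i y"
    and ev_inj: "\<lbrakk>x \<in> A; y \<in> A; \<And>i. ev i x = ev i y\<rbrakk> \<Longrightarrow> x = y"
    and preorder: "total_preorder_on A R"
    and indep: "\<lbrakk>x \<in> A; y \<in> A; z \<in> A; 0 < a; a < 1; strict R x y\<rbrakk> \<Longrightarrow> strict R (m a x z) (m a y z)"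
    and closed_upper: "\<lbrakk>x \<in> A; y \<in> A; z \<in> A\<rbrakk> \<Longrightarrow> closed {a \<in> {0..1}. R (m a x y) z}"
    and closed_lower: "\<lbrakk>x \<in> A; y \<in> A; z \<in> A\<rbrakk> \<Longrightarrow> closed {a \<in> {0..1}. R z (m a x y)}"
begin

lemma R_refl [simp]: "x \<in> A \<Longrightarrow> R x x"
  and R_trans: "\<lbrakk>R x y; R y z; x \<in> A; y \<in> A; z \<in> A\<rbrakk> \<Longrightarrow> R x z"
  and R_total: "\<lbrakk>x \<in> A; y \<in> A\<rbrakk> \<Longrightarrow> R x y \<or> R y x"
  using preorder unfolding total_preorder_on_def by blast+

lemma strict_iff: "\<lbrakk>x \<in> A; y \<in> A\<rbrakk> \<Longrightarrow> strict R x y \<longleftrightarrow> \<not> R y x"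
  using R_total unfolding strict_def by blast

lemma m_one [simp]: "\<lbrakk>x \<in> A; y \<in> A\<rbrakk> \<Longrightarrow> m 1 x y = x"
  and m_zero [simp]: "\<lbrakk>x \<in> A; y \<in> A\<rbrakk> \<Longrightarrow> m 0 x y = y"
  by (rule ev_inj; simp add: ev_m)+

lemma m_same: "\<lbrakk>x \<in> A; 0 \<le> a; a \<le> 1\<rbrakk> \<Longrightarrow> m a x x = x"
  by (rule ev_inj) (simp_all add: ev_m algebra_simps)

lemma m_commute: "\<lbrakk>x \<in> A; y \<in> A; 0 \<le> a; a \<le> 1\<rbrakk> \<Longrightarrow> m a x y = m (1 - a) y x"
  by (rule ev_inj) (simp_all add: ev_m algebra_simps)

lemma m_m_right:
  "\<lbrakk>x \<in> A; y \<in> A; 0 \<le> a; a \<le> 1; 0 \<le> b; b \<le> 1\<rbrakk> \<Longrightarrow> m a (m b x y) y = m (a * b) x y"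
  by (rule ev_inj) (simp_all add: ev_m mult_le_one algebra_simps)

lemma m_distrib:
  "\<lbrakk>x \<in> A; y \<in> A; z \<in> A; 0 \<le> a; a \<le> 1; 0 \<le> b; b \<le> 1\<rbrakk>
    \<Longrightarrow> m a (m b x y) z = m b (m a x z) (m a y z)"
  by (rule ev_inj) (simp_all add: ev_m algebra_simps)

lemma m_m_segment:
  assumes "x \<in> A" "y \<in> A" "0 \<le> a" "a \<le> 1" "0 \<le> s" "s \<le> 1" "0 \<le> t" "t \<le> 1"
  shows "m a (m s x y) (m t x y) = m (a * s + (1 - a) * t) x y"
  using assms convex_comb_bounds[OF assms(3-)]
  by (intro ev_inj) (simp_all add: ev_m algebra_simps)

text \<open>Independence is applied twice: first to \<open>x\<close> over \<open>y\<close>, giving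
  \<open>m t x y\<close> over \<open>y\<close>; then \<open>z = m t x y\<close> is mixed with itself
  and \<open>y\<close> is mixed with \<open>z\<close> at the same weight, the latter mixture being
  \<open>m s x y\<close>.\<close>

lemma m_strict_mono:
  assumes A: "x \<in> A" "y \<in> A" and xy: "strict R x y" and st: "0 \<le> s" "s < t" "t \<le> 1"
  shows "strict R (m t x y) (m s x y)"
proof -
  have above: "strict R (m t x y) y"
    using indep[of x y y t] A xy st m_same[of y t] by (cases "t = 1") auto
  show ?thesis
  proof (cases "s = 0")
    case True
    then show ?thesis using above A by simp
  next
    case False
    define r where "r = s / t"
    have r: "0 < r" "r < 1" "r * t = s" using False st by (auto simp: r_def field_simps)
    define z where "z = m t x y"
    have z: "z \<in> A" using A st by (simp add: z_def)
    have "strict R (m (1 - r) z z) (m (1 - r) y z)"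
      using indep[of z y z "1 - r"] z A r above by (simp add: z_def)
    moreover have "m (1 - r) z z = z" using z r by (simp add: m_same)
    moreover have "m (1 - r) y z = m s x y"
      using m_commute[of y z "1 - r"] m_m_right[of x y r t] A z r st by (simp add: z_def)
    ultimately show ?thesis by (simp add: z_def)
  qed
qed

lemma m_strict_iff:
  assumes "x \<in> A" "y \<in> A" "strict R x y" "0 \<le> s" "s \<le> 1" "0 \<le> t" "t \<le> 1"
  shows "strict R (m t x y) (m s x y) \<longleftrightarrow> s < t"
proof
  assume *: "strict R (m t x y) (m s x y)"
  show "s < t"
  proof (rule ccontr)
    assume "\<not> s < t"
    then consider "s = t" | "t < s" by linarith
    then show False
      using * m_strict_mono[OF assms(1-3,6), of s] assms unfolding strict_def by cases auto
  qed
qed (use m_strict_mono assms in blast)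

section \<open>Indifference and cancellation under mixing\<close>

definition indiff :: "'b \<Rightarrow> 'b \<Rightarrow> bool" where
  "indiff x y \<longleftrightarrow> R x y \<and> R y x"

lemma indiff_trans: "\<lbrakk>indiff x y; indiff y z; x \<in> A; y \<in> A; z \<in> A\<rbrakk> \<Longrightarrow> indiff x z"
  unfolding indiff_def by (meson R_trans)

lemma indiff_sym: "indiff x y \<Longrightarrow> indiff y x"
  unfolding indiff_def by blast

lemma strict_indiff_cong:
  "\<lbrakk>indiff x x'; indiff y y'; x \<in> A; x' \<in> A; y \<in> A; y' \<in> A\<rbrakk> \<Longrightarrow> strict R x y \<longleftrightarrow> strict R x' y'"
  unfolding indiff_def strict_def by (meson R_trans)

text \<open>Independence speaks only of strict preference, so \<open>y\<close> is first moved
  slightly towards the better point \<open>k\<close>; the amount \<open>b\<close> then tends to 0,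
  which closed upper contour sets permit.\<close>

lemma R_m_of_indiff_above:
  assumes A: "x \<in> A" "y \<in> A" "z \<in> A" "k \<in> A" and a: "0 < a" "a < 1"
    and xy: "indiff x y" and k: "strict R k x"
  shows "R (m a y z) (m a x z)"
proof -
  have "R (m b (m a k z) (m a y z)) (m a x z)" if b: "0 < b" "b < 1" for b
  proof -
    have "strict R k y" using k xy A strict_indiff_cong[of k k x y] by (simp add: indiff_def)
    then have "strict R (m b k y) y" using m_strict_mono[of k y 0 b] A b by simp
    then have "strict R (m b k y) x"
      using xy A b strict_indiff_cong[of "m b k y" "m b k y" x y] by (simp add: indiff_def)
    then have "strict R (m a (m b k y) z) (m a x z)"
      using indep[of "m b k y" x z a] A a b by simp
    \<comment> \<open>Distributivity places the perturbed mixture on the segment from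
      \<open>m a k z\<close> to \<open>m a y z\<close>, where \<open>closed_upper\<close>
      applies.\<close>
    then show ?thesis using m_distrib[of k y z a b] A a b by (simp add: strict_def)
  qed
  then have "{0<..<1} \<subseteq> {b \<in> {0..1}. R (m b (m a k z) (m a y z)) (m a x z)}" by auto
  from closed_unit_zero_mem[OF closed_upper this] show ?thesis using A a by simp
qed

text \<open>The mirror image of \<open>R_m_of_indiff_above\<close>: \<open>y\<close> is pushed
  slightly down towards a worse point \<open>k\<close>, and lower contour sets are used.\<close>

lemma R_m_of_indiff_below:
  assumes A: "x \<in> A" "y \<in> A" "z \<in> A" "k \<in> A" and a: "0 < a" "a < 1"
    and xy: "indiff x y" and k: "strict R x k"
  shows "R (m a x z) (m a y z)"
proof -
  have "R (m a x z) (m b (m a k z) (m a y z))" if b: "0 < b" "b < 1" for b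
  proof -
    have "strict R y k" using k xy A strict_indiff_cong[of x y k k] by (simp add: indiff_def)
    then have "strict R (m 1 y k) (m (1 - b) y k)" using m_strict_mono[of y k "1 - b" 1] A b by simp
    then have "strict R y (m b k y)" using A b m_commute[of k y b] by simp
    then have "strict R x (m b k y)"
      using xy A b strict_indiff_cong[of x y "m b k y" "m b k y"] by (simp add: indiff_def)
    then have "strict R (m a x z) (m a (m b k y) z)"
      using indep[of x "m b k y" z a] A a b by simp
    then show ?thesis using m_distrib[of k y z a b] A a b by (simp add: strict_def)
  qed
  then have "{0<..<1} \<subseteq> {b \<in> {0..1}. R (m a x z) (m b (m a k z) (m a y z))}" by auto
  from closed_unit_zero_mem[OF closed_lower this] show ?thesis using A a by simp
qed

lemma indiff_m:
  assumes A: "x \<in> A" "y \<in> A" "z \<in> A" and a: "0 < a" "a < 1" and xy: "indiff x y"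
  shows "indiff (m a x z) (m a y z)"
proof -
  have cong: "strict R k x \<longleftrightarrow> strict R k y" "strict R x k \<longleftrightarrow> strict R y k" if "k \<in> A" for k
    using strict_indiff_cong[of k k x y] strict_indiff_cong[of x y k k] xy A that
    by (auto simp: indiff_def)
  \<comment> \<open>A point strictly above or below serves for the perturbation; if neither exists,
    \<open>x\<close> is indifferent to everything, hence so are both mixtures to each other.\<close>
  consider k where "k \<in> A" "strict R k x" | k where "k \<in> A" "strict R x k"
    | "\<And>k. k \<in> A \<Longrightarrow> R x k \<and> R k x"
    using A strict_iff by blast
  then show ?thesis
  proof cases
    case 1
    then show ?thesis unfolding indiff_def
      using R_m_of_indiff_above A a xy cong indiff_sym by meson
  next
    case 2
    then show ?thesis unfolding indiff_def
      using R_m_of_indiff_below A a xy cong indiff_sym by meson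
  next
    case 3
    then show ?thesis using A a R_trans unfolding indiff_def
      by (meson less_imp_le m_closed)
  qed
qed

text \<open>Cancellation: by totality the only alternatives are indifference and the reverse
  preference, and mixing preserves both.\<close>

lemma strict_m_iff:
  assumes "x \<in> A" "y \<in> A" "z \<in> A" "0 < a" "a < 1"
  shows "strict R (m a x z) (m a y z) \<longleftrightarrow> strict R x y"
proof
  assume *: "strict R (m a x z) (m a y z)"
  show "strict R x y"
  proof (rule ccontr)
    assume "\<not> strict R x y"
    then have "indiff x y \<or> strict R y x" using R_total assms unfolding indiff_def strict_def by blast
    then show False
      using * indiff_m[of x y z a] indep[of y x z a] assms unfolding indiff_def strict_def by blast
  qed
qed (use assms indep in blast)

text \<open>An intermediate value argument: two nonempty closed sets of weights cover the connected
  unit interval, so they meet.\<close>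

lemma calibration:
  assumes A: "x \<in> A" "a \<in> A" "b \<in> A" and "R a x" "R x b"
  shows "\<exists>t\<in>{0..1}. indiff x (m t a b)"
proof -
  let ?U = "{t \<in> {0..1}. R (m t a b) x}" and ?L = "{t \<in> {0..1}. R x (m t a b)}"
  have "closed ?U" "closed ?L" using closed_upper closed_lower A by auto
  moreover have "{0..1} \<subseteq> ?U \<union> ?L"
  proof
    fix t :: real assume "t \<in> {0..1}"
    then show "t \<in> ?U \<union> ?L" using R_total[of "m t a b" x] A by auto
  qed
  moreover have "1 \<in> ?U" "0 \<in> ?L" using assms by auto
  moreover have "connected {0..1::real}" by simp
  ultimately have "?U \<inter> ?L \<inter> {0..1} \<noteq> {}"
    unfolding connected_closed by (metis (no_types, lifting) IntI atLeastAtMost_iff empty_iff zero_le_one order_refl)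
  then show ?thesis unfolding indiff_def by blast
qed

text \<open>The weights at which the mixture leaves the open order interval between \<open>b\<close>
  and \<open>a\<close> form a closed set that omits 0, hence omits a neighbourhood of 0.\<close>

lemma strict_near_zero:
  assumes A: "x \<in> A" "c \<in> A" "a \<in> A" "b \<in> A" and "strict R a c" "strict R c b"
  shows "\<exists>e. 0 < e \<and> e < 1 \<and> strict R a (m e x c) \<and> strict R (m e x c) b"
proof -
  let ?C = "{t \<in> {0..1}. R (m t x c) a} \<union> {t \<in> {0..1}. R b (m t x c)}"
  have "open (- ?C)" using closed_upper closed_lower A by (intro open_Compl closed_Un) auto
  moreover have "0 \<in> - ?C" using assms by (auto simp: strict_iff)
  ultimately obtain d where d: "d > 0" "\<And>t. dist t 0 < d \<Longrightarrow> t \<in> - ?C"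
    unfolding open_dist by blast
  define e where "e = min (d / 2) (1 / 2)"
  have "0 < e" "e < 1" "dist e 0 < d" using d(1) by (auto simp: e_def dist_real_def)
  with d(2)[of e] A show ?thesis by (intro exI[of _ e]) (auto simp: strict_iff)
qed

section \<open>The utility scale fixed by a strictly ranked pair\<close>

context
  fixes a b :: 'b
  assumes ab: "a \<in> A" "b \<in> A" "strict R a b"
begin

definition mid :: 'b where
  "mid = m (1/2) a b"

text \<open>A utility scale with \<open>a\<close> at 1 and \<open>b\<close> at 0: points outside the order interval from \<open>b\<close> to \<open>a\<close>
  are contracted by a factor \<open>e\<close> towards the midpoint, whose utility is 1/2, until they fall into it.\<close>

definition calibrates :: "real \<Rightarrow> 'b \<Rightarrow> real \<Rightarrow> bool" where
  "calibrates e x s \<longleftrightarrow> 0 < e \<and> e < 1 \<and> 0 \<le> e * s + (1 - e) / 2 \<and> e * s + (1 - e) / 2 \<le> 1 \<and>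
     indiff (m e x mid) (m (e * s + (1 - e) / 2) a b)"

lemma mid_in [simp]: "mid \<in> A"
  using ab by (simp add: mid_def)

lemma calibrates_exists:
  assumes "x \<in> A"
  shows "\<exists>e s. calibrates e x s"
proof -
  \<comment> \<open>Since \<open>mid\<close> lies strictly between \<open>b\<close> and
    \<open>a\<close>, a strong enough contraction of \<open>x\<close> towards it does too and can be
    calibrated.\<close>
  have "strict R a mid" "strict R mid b"
    using m_strict_mono[OF ab, of "1/2" 1] m_strict_mono[OF ab, of 0 "1/2"] ab by (simp_all add: mid_def)
  then obtain e where e: "0 < e" "e < 1" "strict R a (m e x mid)" "strict R (m e x mid) b"
    using strict_near_zero[of x mid a b] assms ab by auto
  then obtain t where t: "t \<in> {0..1}" "indiff (m e x mid) (m t a b)"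
    using calibration[of "m e x mid" a b] assms ab by (auto simp: strict_def)
  \<comment> \<open>Solves \<open>e * s + (1 - e) / 2 = t\<close>, undoing the contraction towards
    utility 1/2.\<close>
  define s where "s = (t - (1 - e) / 2) / e"
  have "e * s + (1 - e) / 2 = t" using e by (simp add: s_def)
  then show ?thesis using e t unfolding calibrates_def by (metis atLeastAtMost_iff)
qed

text \<open>Mixing both sides of the indifference with \<open>mid\<close> at weight
  \<open>d / e\<close> contracts further without changing \<open>s\<close>; two points can thus be
  given a common factor.\<close>

lemma calibrates_shrink:
  assumes x: "x \<in> A" and c: "calibrates e x s" and d: "0 < d" "d \<le> e"
  shows "calibrates d x s"
proof (cases "d = e")
  case False
  define r where "r = d / e"
  define t where "t = e * s + (1 - e) / 2"
  have e: "0 < e" "e < 1" and t: "0 \<le> t" "t \<le> 1" and ind: "indiff (m e x mid) (m t a b)"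
    using c unfolding calibrates_def t_def by auto
  have r: "0 < r" "r < 1" "r * e = d" using d e False by (auto simp: r_def field_simps)
  have eq: "r * t + (1 - r) * (1 / 2) = d * s + (1 - d) / 2"
    using r(3) unfolding t_def by (simp add: algebra_simps flip: r(3)) (simp add: field_simps)
  have "indiff (m r (m e x mid) mid) (m r (m t a b) mid)"
    using indiff_m[OF _ _ _ r(1,2) ind] x e t ab by simp
  moreover have "m r (m e x mid) mid = m d x mid"
    using m_m_right[of x mid r e] x e r by simp
  moreover have "m r (m t a b) mid = m (d * s + (1 - d) / 2) a b"
    using m_m_segment[of a b r t "1/2", unfolded eq] ab r t by (simp add: mid_def)
  ultimately show ?thesis
    using convex_comb_bounds[of r t "1/2", unfolded eq] d e r t unfolding calibrates_def by simp
qed (use c in simp)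

text \<open>With a common factor, \<open>strict_m_iff\<close> cancels the contraction, and on the
  segment between \<open>b\<close> and \<open>a\<close> preference is the order of the
  weights.\<close>

lemma calibrates_strict_iff:
  assumes A: "x \<in> A" "y \<in> A" and c: "calibrates e x s" "calibrates e y r"
  shows "strict R x y \<longleftrightarrow> s > r"
proof -
  have "strict R x y \<longleftrightarrow> strict R (m e x mid) (m e y mid)"
    using strict_m_iff[of x y mid e] A c unfolding calibrates_def by simp
  also have "\<dots> \<longleftrightarrow> strict R (m (e * s + (1 - e) / 2) a b) (m (e * r + (1 - e) / 2) a b)"
    using c A ab unfolding calibrates_def by (intro strict_indiff_cong) auto
  also have "\<dots> \<longleftrightarrow> s > r"
    using c m_strict_iff[OF ab] unfolding calibrates_def by auto
  finally show ?thesis .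
qed

lemma calibrates_common:
  assumes "x \<in> A" "y \<in> A" "calibrates e x s" "calibrates d y r"
  shows "calibrates (min e d) x s" "calibrates (min e d) y r"
  using assms calibrates_shrink[of x e s "min e d"] calibrates_shrink[of y d r "min e d"]
  by (auto simp: calibrates_def)

text \<open>Two different values of one point would, at a common factor, make it strictly preferred
  to itself.\<close>

lemma calibrates_unique:
  assumes "x \<in> A" "calibrates e x s" "calibrates d x r"
  shows "s = r"
  using calibrates_strict_iff[of x x] calibrates_common[of x x e s d r] assms
  by (metis linorder_neqE strict_def)

text \<open>The two contracted points are replaced one after the other by their reference
  mixtures.\<close>

lemma calibrates_m:
  assumes A: "x \<in> A" "y \<in> A" and t: "0 < t" "t < 1" and c: "calibrates e x s" "calibrates e y r"
  shows "calibrates e (m t x y) (t * s + (1 - t) * r)"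
proof -
  define s' r' where "s' = e * s + (1 - e) / 2" and "r' = e * r + (1 - e) / 2"
  have e: "0 < e" "e < 1" and s': "0 \<le> s'" "s' \<le> 1" and r': "0 \<le> r'" "r' \<le> 1"
    and ind: "indiff (m e x mid) (m s' a b)" "indiff (m e y mid) (m r' a b)"
    using c unfolding calibrates_def s'_def r'_def by auto
  have eq: "e * (t * s + (1 - t) * r) + (1 - e) / 2 = t * s' + (1 - t) * r'"
    unfolding s'_def r'_def by (simp add: field_simps)
  note cl = A e t s' r' ab
  have 1: "indiff (m t (m e x mid) (m e y mid)) (m t (m s' a b) (m e y mid))"
    using cl ind(1) by (intro indiff_m) auto
  \<comment> \<open>\<open>indiff_m\<close> substitutes in the first component only, so the second
    one is reached by swapping components.\<close>
  have "indiff (m (1 - t) (m e y mid) (m s' a b)) (m (1 - t) (m r' a b) (m s' a b))"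
    using cl ind(2) by (intro indiff_m) auto
  then have 2: "indiff (m t (m s' a b) (m e y mid)) (m t (m s' a b) (m r' a b))"
    using m_commute[of "m s' a b" "m e y mid" t] m_commute[of "m s' a b" "m r' a b" t] cl by simp
  have "indiff (m t (m e x mid) (m e y mid)) (m t (m s' a b) (m r' a b))"
    using indiff_trans[OF 1 2] cl by simp
  moreover have "m t (m e x mid) (m e y mid) = m e (m t x y) mid"
    using m_distrib[of x y mid e t] cl by simp
  moreover have "m t (m s' a b) (m r' a b) = m (t * s' + (1 - t) * r') a b"
    using cl by (intro m_m_segment) auto
  ultimately show ?thesis
    using convex_comb_bounds[of t s' r'] e t s' r' unfolding calibrates_def eq by simp
qed

end

theorem affine_utility_exists:
  "\<exists>U. (\<forall>x\<in>A. \<forall>y\<in>A. strict R x y \<longleftrightarrow> U x > U y) \<and>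
     (\<forall>x\<in>A. \<forall>y\<in>A. \<forall>t\<in>{0..1}. U (m t x y) = t * U x + (1 - t) * (U y :: real))"
proof (cases "\<exists>a\<in>A. \<exists>b\<in>A. strict R a b")
  \<comment> \<open>Without a strictly ranked pair there is no scale to calibrate, and a constant
    utility represents \<open>R\<close>.\<close>
  case False
  then show ?thesis by (intro exI[of _ "\<lambda>_. 0"]) auto
next
  case True
  then obtain a b where ab: "a \<in> A" "b \<in> A" "strict R a b" by blast
  \<comment> \<open>The choice is harmless by \<open>calibrates_unique\<close>; the factor
    \<open>e\<close> may depend on the point and is made common when two points are
    compared.\<close>
  define U where "U x = (SOME s. \<exists>e. calibrates a b e x s)" for x
  have U: "\<exists>e. calibrates a b e x (U x)" if "x \<in> A" for x
    unfolding U_def by (rule someI_ex) (use calibrates_exists[OF ab that] in blast)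
  have common: "\<exists>e. calibrates a b e x (U x) \<and> calibrates a b e y (U y)" if "x \<in> A" "y \<in> A" for x y
    using U[OF that(1)] U[OF that(2)] calibrates_common[OF ab that] by blast
  show ?thesis
  proof (intro exI[of _ U] conjI ballI)
    fix x y assume xy: "x \<in> A" "y \<in> A"
    then show "strict R x y \<longleftrightarrow> U x > U y" using common calibrates_strict_iff[OF ab] by blast
  next
    fix x y and t :: real assume xy: "x \<in> A" "y \<in> A" and t: "t \<in> {0..1}"
    show "U (m t x y) = t * U x + (1 - t) * U y"
    proof (cases "t = 0 \<or> t = 1")
      case True
      then show ?thesis using xy by auto
    next
      case False
      then obtain e where "calibrates a b e x (U x)" "calibrates a b e y (U y)"
        using common xy by blast
      then have "calibrates a b e (m t x y) (t * U x + (1 - t) * U y)"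
        using calibrates_m[OF ab xy] False t by simp
      moreover have "m t x y \<in> A" using xy t by simp
      ultimately show ?thesis using calibrates_unique[OF ab] U by blast
    qed
  qed
qed

end

section \<open>Mixtures of measures\<close>

lemma sets_mix [simp, measurable_cong]: "sets (mix a M N) = sets borel"
  unfolding mix_def by (subst sets_measure_of) (auto simp: sets.sigma_sets_eq[of borel, simplified])

lemma space_mix [simp]: "space (mix a M N) = UNIV"
  using sets_eq_imp_space_eq[OF sets_mix] by simp

lemma emeasure_mix:
  assumes sets: "sets M = sets borel" "sets N = sets borel"
  shows "emeasure (mix a M N) B = ennreal a * emeasure M B + ennreal (1 - a) * emeasure N B"
proof (cases "B \<in> sets borel")
  case True
  show ?thesis
  proof (rule emeasure_measure_of[OF mix_def])
    show "countably_additive (sets (mix a M N))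
      (\<lambda>A. ennreal a * emeasure M A + ennreal (1 - a) * emeasure N A)"
    proof (rule countably_additiveI)
      fix F :: "nat \<Rightarrow> _" assume F: "range F \<subseteq> sets (mix a M N)" "disjoint_family F"
      then have "range F \<subseteq> sets M" "range F \<subseteq> sets N" using sets by auto
      then show "(\<Sum>i. ennreal a * emeasure M (F i) + ennreal (1 - a) * emeasure N (F i)) =
        ennreal a * emeasure M (\<Union>i. F i) + ennreal (1 - a) * emeasure N (\<Union>i. F i)"
        using F(2) by (simp add: suminf_emeasure flip: suminf_add)
    qed
  qed (use True in \<open>auto simp: positive_def\<close>)
next
  case False
  then show ?thesis using sets by (simp add: emeasure_notin_sets)
qed

lemma prob_space_mix:
  assumes "sets M = sets borel" "sets N = sets borel" "prob_space M" "prob_space N" "0 \<le> a" "a \<le> 1"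
  shows "prob_space (mix a M N)"
proof (rule prob_spaceI)
  have "space M = UNIV" "space N = UNIV"
    using assms(1,2)[THEN sets_eq_imp_space_eq] by simp_all
  then show "emeasure (mix a M N) (space (mix a M N)) = 1"
    using assms prob_space.emeasure_space_1[of M] prob_space.emeasure_space_1[of N]
    by (simp add: emeasure_mix flip: ennreal_plus)
qed

lemma measure_mix:
  assumes "sets M = sets borel" "sets N = sets borel" "prob_space M" "prob_space N" "0 \<le> a" "a \<le> 1"
  shows "measure (mix a M N) B = a * measure M B + (1 - a) * measure N B"
proof -
  interpret M: prob_space M by fact
  interpret N: prob_space N by fact
  have "emeasure (mix a M N) B = ennreal (a * measure M B + (1 - a) * measure N B)"
    using assms by (simp add: emeasure_mix M.emeasure_eq_measure N.emeasure_eq_measure ennreal_mult)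
  moreover have "0 \<le> a * measure M B + (1 - a) * measure N B" using assms by simp
  ultimately show ?thesis by (subst measure_def) (metis enn2real_ennreal)
qed

lemma prob_measure_eqI:
  assumes "sets M = sets N" "prob_space M" "prob_space N" "\<And>B. measure M B = measure N B"
  shows "M = N"
proof (rule measure_eqI)
  interpret M: prob_space M by fact
  interpret N: prob_space N by fact
  show "emeasure M B = emeasure N B" for B
    using assms by (simp add: M.emeasure_eq_measure N.emeasure_eq_measure)
qed fact

lemma nn_integral_mix:
  assumes sets: "sets M = sets borel" "sets N = sets borel" and f: "f \<in> borel_measurable borel"
  shows "(\<integral>\<^sup>+x. f x \<partial>mix a M N) = ennreal a * (\<integral>\<^sup>+x. f x \<partial>M) + ennreal (1 - a) * (\<integral>\<^sup>+x. f x \<partial>N)"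
  using f
proof (induction rule: borel_measurable_induct)
  note [measurable_cong] = sets
  {
    case (cong f g)
    then show ?case by (metis ext UNIV_I space_borel)
  next
    case (set B)
    then show ?case using sets by (simp add: emeasure_mix)
  next
    case (mult u c)
    have [measurable]: "u \<in> borel_measurable borel" by fact
    show ?case using mult by (simp add: nn_integral_cmult distrib_left mult.left_commute)
  next
    case (add u v)
    have [measurable]: "u \<in> borel_measurable borel" "v \<in> borel_measurable borel" by fact+
    show ?case using add by (simp add: nn_integral_add distrib_left ac_simps)
  next
    case (seq U)
    have [measurable]: "\<And>i. U i \<in> borel_measurable borel" by fact
    have eq: "(\<integral>\<^sup>+x. (SUP i. U i) x \<partial>K) = (SUP i. \<integral>\<^sup>+x. U i x \<partial>K)" if "sets K = sets borel" for K
    proof -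
      note [measurable_cong] = that
      show ?thesis
        using nn_integral_monotone_convergence_SUP[OF \<open>incseq U\<close>, of K] by (simp add: image_comp)
    qed
    have inc: "incseq (\<lambda>i. ennreal c * (\<integral>\<^sup>+x. U i x \<partial>K))" for c K
      using seq by (auto simp: incseq_def le_fun_def intro!: mult_left_mono nn_integral_mono)
    show ?case
      unfolding eq[OF sets(1)] eq[OF sets(2)] eq[OF sets_mix] seq.IH SUP_mult_left_ennreal
      by (rule ennreal_SUP_add[OF inc inc])
  }
qed

lemma integrable_mix:
  fixes f :: "'a::topological_space \<Rightarrow> 'b::{banach, second_countable_topology}"
  assumes sets: "sets M = sets borel" "sets N = sets borel"
    and int: "integrable M f" "integrable N f"
  shows "integrable (mix a M N) f"
proof -
  have [measurable]: "f \<in> borel_measurable borel"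
    using borel_measurable_integrable[OF int(1)] measurable_cong_sets[OF sets(1) refl] by blast
  show ?thesis
    using int by (auto simp: integrable_iff_bounded nn_integral_mix[OF sets] ennreal_mult_less_top)
qed

lemma mix_one_zero:
  assumes "sets M = sets borel" "sets N = sets borel"
  shows "mix 1 M N = M" "mix 0 M N = N"
  using assms by (auto intro!: measure_eqI simp: emeasure_mix)

lemma integral_mix:
  fixes f :: "'a::topological_space \<Rightarrow> 'b::{banach, second_countable_topology}"
  assumes sets: "sets M = sets borel" "sets N = sets borel" and prob: "prob_space M" "prob_space N"
    and int: "integrable M f" "integrable N f" and a: "0 \<le> a" "a \<le> 1"
  shows "integral\<^sup>L (mix a M N) f = a *\<^sub>R integral\<^sup>L M f + (1 - a) *\<^sub>R integral\<^sup>L N f"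
proof (cases "a = 0 \<or> a = 1")
  case True
  then show ?thesis using mix_one_zero[OF sets] by auto
next
  case False
  then have a': "0 < a" "a < 1" using a by auto
  \<comment> \<open>The induction below runs over functions integrable for the mixture; positive
    weights make these integrable for both components. At weights 0 and 1 this can fail, hence the
    case split.\<close>
  have both: "integrable M f \<and> integrable N f" if "integrable (mix a M N) f" for f :: "'a \<Rightarrow> 'b"
  proof -
    have m: "f \<in> borel_measurable borel"
      using borel_measurable_integrable[OF that] measurable_cong_sets[OF sets_mix refl] by blast
    then have "f \<in> borel_measurable M" "f \<in> borel_measurable N"
      using measurable_cong_sets[OF sets(1) refl] measurable_cong_sets[OF sets(2) refl] by blast+
    moreover have "(\<integral>\<^sup>+x. norm (f x) \<partial>mix a M N) < \<infinity>" using that by (simp add: integrable_iff_bounded)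
    then have "(\<integral>\<^sup>+x. norm (f x) \<partial>M) < \<infinity>" "(\<integral>\<^sup>+x. norm (f x) \<partial>N) < \<infinity>"
      using m a' by (auto simp: nn_integral_mix[OF sets] ennreal_mult_less_top)
    ultimately show ?thesis by (simp add: integrable_iff_bounded)
  qed
  have "integrable (mix a M N) f" using integrable_mix[OF sets int] .
  then show ?thesis
  proof (induction rule: integrable_induct)
    case (base B c)
    have indicator: "(\<integral>x. indicator B x *\<^sub>R c \<partial>K) = measure K B *\<^sub>R c"
      if K: "sets K = sets borel" "prob_space K" for K
    proof -
      interpret prob_space K by fact
      have "B \<in> sets K" using base K by simp
      then show ?thesis
        by (subst integral_scaleR_left) (simp_all add: integrable_real_indicator emeasure_eq_measure)
    qed
    show ?case
      using sets prob prob_space_mix[OF sets prob a]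
      by (simp only: indicator sets_mix measure_mix[OF sets prob a] scaleR_left_distrib scaleR_scaleR)
  next
    case (add f g)
    then show ?case using both[of f] both[of g] by (simp add: algebra_simps)
  next
    case (lim f s)
    have "(\<lambda>i. integral\<^sup>L K (s i)) \<longlonglongrightarrow> integral\<^sup>L K f"
      if K: "sets K = sets borel" "integrable K f" "\<And>i. integrable K (s i)" for K
    proof (rule integral_dominated_convergence[where w="\<lambda>x. 2 * norm (f x)"])
      show "AE x in K. (\<lambda>i. s i x) \<longlonglongrightarrow> f x" using lim by auto
      show "AE x in K. norm (s i x) \<le> 2 * norm (f x)" for i using lim by auto
    qed (use K in auto)
    note conv = this
    have "(\<lambda>i. integral\<^sup>L (mix a M N) (s i)) \<longlonglongrightarrow> integral\<^sup>L (mix a M N) f"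
      using lim by (intro conv) auto
    moreover have "(\<lambda>i. a *\<^sub>R integral\<^sup>L M (s i) + (1 - a) *\<^sub>R integral\<^sup>L N (s i)) \<longlonglongrightarrow>
        a *\<^sub>R integral\<^sup>L M f + (1 - a) *\<^sub>R integral\<^sup>L N f"
      using lim both sets by (intro tendsto_intros conv) auto
    ultimately show ?case using lim LIMSEQ_unique by auto
  qed
qed

section \<open>Probability measures with finite \<open>p\<close>-th moment\<close>

lemma P_psiD:
  assumes "M \<in> P_psi p"
  shows "sets M = sets borel" "space M = UNIV" "prob_space M" "integrable M (\<lambda>z. norm z powr p)"
  using assms sets_eq_imp_space_eq[of M borel] by (auto simp: P_psi_def)

lemma mix_in_P_psi:
  "\<lbrakk>M \<in> P_psi p; N \<in> P_psi p; 0 \<le> a; a \<le> 1\<rbrakk> \<Longrightarrow> mix a M N \<in> P_psi p"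
  by (simp add: P_psi_def prob_space_mix integrable_mix)

lemma distr_in_P_psi:
  assumes M: "M \<in> P_psi p" and p: "0 \<le> p" and F: "F \<in> borel_measurable M"
    and bnd: "\<And>x. norm (F x) \<le> c * norm x"
  shows "distr M borel F \<in> P_psi p"
proof -
  note [measurable] = F
  \<comment> \<open>\<open>c\<close> has no sign hypothesis; its absolute value keeps the base of
    the power nonnegative.\<close>
  have bound: "norm (F x) powr p \<le> (\<bar>c\<bar> * norm x) powr p" for x
    using p order.trans[OF bnd[of x] mult_right_mono[OF abs_ge_self norm_ge_zero]]
    by (intro powr_mono2) auto
  have "integrable M (\<lambda>z. \<bar>c\<bar> powr p * norm z powr p)"
    using P_psiD(4)[OF M] by (rule integrable_mult_right)
  then have "integrable M (\<lambda>x. norm (F x) powr p)"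
  proof (rule Bochner_Integration.integrable_bound)
    show "AE x in M. norm (norm (F x) powr p) \<le> norm (\<bar>c\<bar> powr p * norm x powr p)"
      using bound by (intro AE_I2) (simp add: powr_mult)
  qed measurable
  then show ?thesis
    using prob_space.prob_space_distr[OF P_psiD(3)[OF M] F] by (simp add: P_psi_def integrable_distr_eq)
qed

lemma return_in_P_psi [simp]: "return borel z \<in> P_psi p"
proof -
  have "integrable (return borel z) (\<lambda>z. norm z powr p)"
    by (auto simp: integrable_iff_bounded nn_integral_return)
  then show ?thesis by (simp add: P_psi_def prob_space_return)
qed

lemma psi_pos: "0 < psi p z" "1 \<le> psi p z"
  by (auto simp: psi_def add_pos_nonneg)

lemma Cb_psi_bound:
  assumes "f \<in> Cb_psi (psi p)"
  obtains C where "\<And>z. \<bar>f z\<bar> \<le> C * psi p z"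
proof -
  obtain C where "\<And>z. norm (f z / psi p z) \<le> C"
    using assms unfolding Cb_psi_def bounded_iff by auto
  then have "\<bar>f z\<bar> / psi p z \<le> C" for z
    using psi_pos(1)[of p z] by (metis abs_divide abs_of_pos real_norm_def)
  then have "\<bar>f z\<bar> \<le> C * psi p z" for z
    using psi_pos(1)[of p z] by (metis pos_divide_le_eq)
  then show ?thesis using that by blast
qed

lemma Cb_psi_measurable: "f \<in> Cb_psi w \<Longrightarrow> f \<in> borel_measurable borel"
  by (simp add: Cb_psi_def borel_measurable_continuous_onI)

lemma Cb_psi_integrable:
  assumes "f \<in> Cb_psi (psi p)" "M \<in> P_psi p"
  shows "integrable M f"
proof -
  note M = P_psiD[OF assms(2)]
  interpret prob_space M by fact
  note [measurable_cong] = M(1)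
  have [measurable]: "f \<in> borel_measurable borel" using Cb_psi_measurable[OF assms(1)] .
  obtain C where C: "\<And>z. \<bar>f z\<bar> \<le> C * psi p z" using Cb_psi_bound[OF assms(1)] by blast
  have "integrable M (\<lambda>z. C * psi p z)" using M(4) by (simp add: psi_def)
  then show ?thesis
    by (rule Bochner_Integration.integrable_bound) (use C in \<open>auto intro: order.trans[OF _ abs_ge_self]\<close>)
qed

lemma integral_mix_Cb_psi:
  assumes "f \<in> Cb_psi (psi p)" "M \<in> P_psi p" "N \<in> P_psi p" "0 \<le> a" "a \<le> 1"
  shows "integral\<^sup>L (mix a M N) f = a * integral\<^sup>L M f + (1 - a) * integral\<^sup>L N f"
  using integral_mix[OF P_psiD(1,1,3,3) Cb_psi_integrable Cb_psi_integrable, of M p N p p p f p p a] assms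
  by simp

lemma integral_return_Cb_psi:
  "f \<in> Cb_psi w \<Longrightarrow> integral\<^sup>L (return borel z) f = f z"
  by (simp add: integral_return Cb_psi_measurable)

section \<open>Sequential continuity\<close>

text \<open>Convergence against all test functions puts the sequence eventually into each subbasic
  set around the limit; finite intersections and unions preserve this.\<close>

lemma psi_weak_open_eventually:
  assumes W: "openin (psi_weak_topology p) W" "M \<in> W" and X: "\<And>n. X n \<in> P_psi p"
    and conv: "\<And>f. f \<in> Cb_psi (psi p) \<Longrightarrow> (\<lambda>n. integral\<^sup>L (X n) f) \<longlonglongrightarrow> integral\<^sup>L M f"
  shows "eventually (\<lambda>n. X n \<in> W) sequentially"
proof -
  obtain T where T: "generate_topology_on
      {{M \<in> P_psi p. integral\<^sup>L M f \<in> V} | f V. f \<in> Cb_psi (psi p) \<and> open V} T"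
    and WT: "W = T \<inter> P_psi p"
    using W(1) unfolding psi_weak_topology_def openin_subtopology openin_topology_generated_by_iff by blast
  have "M \<in> T \<Longrightarrow> eventually (\<lambda>n. X n \<in> T) sequentially" using T
  proof induction
    case (Int a b)
    then show ?case by (auto intro: eventually_conj)
  next
    case (UN K)
    then obtain k where "k \<in> K" "eventually (\<lambda>n. X n \<in> k) sequentially" by blast
    then show ?case by (auto elim: eventually_mono)
  next
    case (Basis s)
    then obtain f V where s: "s = {M \<in> P_psi p. integral\<^sup>L M f \<in> V}" "f \<in> Cb_psi (psi p)" "open V"
      by blast
    then have "eventually (\<lambda>n. integral\<^sup>L (X n) f \<in> V) sequentially"
      using topological_tendstoD[OF conv] Basis by auto
    then show ?case using s X by simp
  qed auto
  then show ?thesis using W(2) X by (simp add: WT)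
qed

lemma topspace_psi_weak_topology: "topspace (psi_weak_topology p) = P_psi p"
proof -
  \<comment> \<open>The zero function with \<open>V = UNIV\<close> makes \<open>P_psi p\<close> a
    subbasic set.\<close>
  have "(\<lambda>_. 0) \<in> Cb_psi (psi p)" by (auto simp: Cb_psi_def)
  then show ?thesis unfolding psi_weak_topology_def by auto
qed

lemma psi_weak_closed_eventually_notin:
  assumes "closedin (psi_weak_topology p) C" "M \<in> P_psi p" "M \<notin> C" "\<And>n. X n \<in> P_psi p"
    and "\<And>f. f \<in> Cb_psi (psi p) \<Longrightarrow> (\<lambda>n. integral\<^sup>L (X n) f) \<longlonglongrightarrow> integral\<^sup>L M f"
  shows "eventually (\<lambda>n. X n \<notin> C) sequentially"
  using psi_weak_open_eventually[of p "P_psi p - C" M X] assms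
  by (auto simp: closedin_def topspace_psi_weak_topology elim: eventually_mono)

text \<open>Integrals of test functions are affine in the weight, so convergent weights yield
  \<psi>-weakly convergent mixtures.\<close>

lemma closed_mixtures:
  assumes C: "closedin (psi_weak_topology p) C" and MN: "M \<in> P_psi p" "N \<in> P_psi p"
  shows "closed {a \<in> {0..1}. mix a M N \<in> C}"
  unfolding closed_sequential_limits
proof safe
  fix x l assume x: "\<forall>n. x n \<in> {a \<in> {0..1}. mix a M N \<in> C}" and l: "x \<longlonglongrightarrow> l"
  show l01: "l \<in> {0..1}" using closed_sequentially[OF closed_atLeastAtMost _ l, of 0 1] x by auto
  show "mix l M N \<in> C"
  proof (rule ccontr)
    assume "mix l M N \<notin> C"
    moreover have "(\<lambda>n. integral\<^sup>L (mix (x n) M N) f) \<longlonglongrightarrow> integral\<^sup>L (mix l M N) f"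
      if "f \<in> Cb_psi (psi p)" for f
      using integral_mix_Cb_psi[OF that MN] x l01 by (auto intro!: tendsto_intros l)
    ultimately have "eventually (\<lambda>n. mix (x n) M N \<notin> C) sequentially"
      using l01 x MN by (intro psi_weak_closed_eventually_notin[OF C, of "mix l M N"]) (auto intro: mix_in_P_psi)
    then show False using x by simp
  qed
qed

text \<open>The evaluations are the measures of sets, which determine a probability measure and are
  affine under \<open>mix\<close>.\<close>

lemma preference_mixture_preference:
  assumes "total_preorder_on (P_psi p) R" "pref_continuous p R" "independence_axiom p R"
  shows "mixture_preference (P_psi p) mix (\<lambda>B M. measure M B) R"
proof
  fix M N K :: "'a measure" assume MN: "M \<in> P_psi p" "N \<in> P_psi p"
  {
    fix a :: real assume a: "0 \<le> a" "a \<le> 1"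
    show "mix a M N \<in> P_psi p" using MN a by (rule mix_in_P_psi)
    show "measure (mix a M N) B = a * measure M B + (1 - a) * measure N B" for B
      using MN a by (intro measure_mix P_psiD)
  next
    assume "\<And>B. measure M B = measure N B"
    then show "M = N" using P_psiD[OF MN(1)] P_psiD[OF MN(2)] by (intro prob_measure_eqI) auto
  next
    assume K: "K \<in> P_psi p"
    {
      fix a :: real assume "0 < a" "a < 1" "strict R M N"
      then show "strict R (mix a M K) (mix a N K)"
        using assms(3) MN K unfolding independence_axiom_def by blast
    }
    have eq: "{a \<in> {0..1}. R (mix a M N) K} = {a \<in> {0..1}. mix a M N \<in> {L \<in> P_psi p. R L K}}"
      "{a \<in> {0..1}. R K (mix a M N)} = {a \<in> {0..1}. mix a M N \<in> {L \<in> P_psi p. R K L}}"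
      using MN mix_in_P_psi by auto
    show "closed {a \<in> {0..1}. R (mix a M N) K}" "closed {a \<in> {0..1}. R K (mix a M N)}"
      unfolding eq using assms(2) MN K unfolding pref_continuous_def by (blast intro: closed_mixtures)+
  }
qed fact

section \<open>Continuity of an affine utility under weak convergence\<close>

locale affine_utility =
  fixes p :: real and R :: "'a::{banach, second_countable_topology} measure \<Rightarrow> 'a measure \<Rightarrow> bool"
    and U :: "'a measure \<Rightarrow> real"
  assumes p_ge_1: "1 \<le> p"
    and preorder: "total_preorder_on (P_psi p) R"
    and cont: "pref_continuous p R"
    and repr: "\<lbrakk>M \<in> P_psi p; N \<in> P_psi p\<rbrakk> \<Longrightarrow> strict R M N \<longleftrightarrow> U M > U N"
    and aff: "\<lbrakk>M \<in> P_psi p; N \<in> P_psi p; 0 \<le> a; a \<le> 1\<rbrakk> \<Longrightarrow> U (mix a M N) = a * U M + (1 - a) * U N"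
begin

lemma R_iff: "\<lbrakk>M \<in> P_psi p; N \<in> P_psi p\<rbrakk> \<Longrightarrow> R M N \<longleftrightarrow> U M \<ge> U N"
  using repr[of N M] preorder unfolding strict_def total_preorder_on_def by (metis linorder_not_less)

text \<open>Closedness is known for contour sets of lotteries, so the level \<open>a\<close> is
  replaced by a lottery: mixing \<open>M\<close> with a worse \<open>K\<close> gives a utility at
  least \<open>a\<close> and below \<open>U M\<close>. Its closed lower contour set omits
  \<open>M\<close>, hence eventually omits \<open>X n\<close>. If no worse lottery exists,
  \<open>U M\<close> is the minimum.\<close>

lemma utility_eventually_greater:
  assumes X: "\<And>n. X n \<in> P_psi p" and M: "M \<in> P_psi p" and a: "a < U M"
    and conv: "\<And>f. f \<in> Cb_psi (psi p) \<Longrightarrow> (\<lambda>n. integral\<^sup>L (X n) f) \<longlonglongrightarrow> integral\<^sup>L M f"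
  shows "eventually (\<lambda>n. a < U (X n)) sequentially"
proof (cases "\<exists>K\<in>P_psi p. U K < U M")
  case True
  then obtain K where K: "K \<in> P_psi p" "U K < U M" by blast
  \<comment> \<open>Mixing in \<open>K\<close> with weight \<open>t\<close> lowers the utility by
    \<open>t * (U M - U K)\<close>, which must not exceed \<open>U M - a\<close>; the cap at 1 keeps
    \<open>t\<close> a weight.\<close>
  define t where "t = min 1 ((U M - a) / (U M - U K))"
  have t: "0 < t" "t \<le> 1" using K a by (auto simp: t_def)
  have "t * (U M - U K) \<le> U M - a" using K by (auto simp: t_def min_def field_simps)
  moreover have "0 < t * (U M - U K)" using t K by simp
  ultimately have L: "mix t K M \<in> P_psi p" "a \<le> U (mix t K M)" "U (mix t K M) < U M"
    using K M t by (auto simp: aff algebra_simps intro: mix_in_P_psi)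
  have "closedin (psi_weak_topology p) {\<nu> \<in> P_psi p. R (mix t K M) \<nu>}"
    using cont L unfolding pref_continuous_def by blast
  then have "eventually (\<lambda>n. X n \<notin> {\<nu> \<in> P_psi p. R (mix t K M) \<nu>}) sequentially"
    using L M X conv by (intro psi_weak_closed_eventually_notin[of p _ M]) (auto simp: R_iff)
  then show ?thesis by (rule eventually_mono) (use L X in \<open>auto simp: R_iff\<close>)
next
  case False
  then show ?thesis using a X by (intro always_eventually allI) (meson linorder_not_less less_le_trans)
qed

end

text \<open>This symmetry turns the eventual lower bounds of
  \<open>utility_eventually_greater\<close> into upper bounds.\<close>

lemma affine_utility_dual:
  assumes "affine_utility p R U"
  shows "affine_utility p (\<lambda>x y. R y x) (\<lambda>x. - U x)"
proof -
  interpret affine_utility p R U by fact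
  show ?thesis
  proof
    show "total_preorder_on (P_psi p) (\<lambda>x y. R y x)"
      using preorder unfolding total_preorder_on_def by meson
    show "pref_continuous p (\<lambda>x y. R y x)"
      using cont unfolding pref_continuous_def by blast
  qed (use p_ge_1 repr aff in \<open>auto simp: strict_def algebra_simps\<close>)
qed

context affine_utility
begin

lemma utility_tendsto:
  assumes X: "\<And>n. X n \<in> P_psi p" and M: "M \<in> P_psi p"
    and conv: "\<And>f. f \<in> Cb_psi (psi p) \<Longrightarrow> (\<lambda>n. integral\<^sup>L (X n) f) \<longlonglongrightarrow> integral\<^sup>L M f"
  shows "(\<lambda>n. U (X n)) \<longlonglongrightarrow> U M"
proof (rule order_tendstoI)
  interpret dual: affine_utility p "\<lambda>x y. R y x" "\<lambda>x. - U x"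
    by (rule affine_utility_dual) unfold_locales
  fix a assume "U M < a"
  then show "eventually (\<lambda>n. U (X n) < a) sequentially"
    using dual.utility_eventually_greater[OF X M, of "- a"] conv by simp
qed (use utility_eventually_greater X M conv in blast)

section \<open>The utility of sure outcomes\<close>

definition u :: "'a \<Rightarrow> real" where
  "u z = U (return borel z)"

lemma continuous_u: "continuous_on UNIV u"
  unfolding continuous_on_sequentially comp_def u_def
proof safe
  fix x :: "nat \<Rightarrow> 'a" and z assume x: "x \<longlonglongrightarrow> z"
  show "(\<lambda>n. U (return borel (x n))) \<longlonglongrightarrow> U (return borel z)"
  proof (rule utility_tendsto)
    fix f :: "'a \<Rightarrow> real" assume f: "f \<in> Cb_psi (psi p)"
    then have "isCont f z" by (simp add: Cb_psi_def continuous_on_eq_continuous_at)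
    then show "(\<lambda>n. integral\<^sup>L (return borel (x n)) f) \<longlonglongrightarrow> integral\<^sup>L (return borel z) f"
      using f x by (simp add: integral_return_Cb_psi isCont_tendsto_compose)
  qed auto
qed

text \<open>If \<open>\<bar>u\<bar>/\<psi>\<close> were unbounded along \<open>z\<^sub>n\<close>, then moving mass \<open>1/\<bar>u z\<^sub>n\<bar>\<close> from 0 to \<open>z\<^sub>n\<close> would
  be negligible in the weak topology but change the utility by about 1.\<close>

lemma u_growth: "\<exists>C. \<forall>z. \<bar>u z\<bar> \<le> C * psi p z"
proof (rule ccontr)
  assume "\<not> ?thesis"
  then have "\<forall>n::nat. \<exists>z. real (Suc n) * psi p z < \<bar>u z\<bar>" by (metis linorder_not_less)
  then obtain z where z: "\<And>n. real (Suc n) * psi p (z n) < \<bar>u (z n)\<bar>" by metis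
  define e where "e n = 1 / \<bar>u (z n)\<bar>" for n
  have u_pos: "0 < \<bar>u (z n)\<bar>" for n
    using z[of n] psi_pos[of p "z n"] by (meson less_trans mult_pos_pos of_nat_0_less_iff zero_less_Suc)
  have e_psi: "e n * psi p (z n) \<le> inverse (real (Suc n))" for n
    using z[of n] u_pos[of n] by (simp add: e_def field_simps)
  have e_pos: "0 \<le> e n" for n by (simp add: e_def)
  have e_inv: "e n \<le> inverse (real (Suc n))" for n
    using e_psi[of n] psi_pos(2)[of p "z n"] e_pos[of n] by (metis mult.right_neutral mult_left_mono order.trans)
  have e_le: "e n \<le> 1" for n
    using e_inv[of n] by (rule order.trans) (simp add: field_simps)
  have e0: "e \<longlonglongrightarrow> 0"
    by (rule tendsto_sandwich[OF _ _ tendsto_const LIMSEQ_inverse_real_of_nat]) (use e_inv e_pos in auto)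
  have "(\<lambda>n. U (mix (e n) (return borel (z n)) (return borel 0))) \<longlonglongrightarrow> U (return borel 0)"
  proof (rule utility_tendsto)
    fix f :: "'a \<Rightarrow> real" assume f: "f \<in> Cb_psi (psi p)"
    then obtain C where C: "\<And>z. \<bar>f z\<bar> \<le> C * psi p z" using Cb_psi_bound by blast
    have "C \<ge> 0" using C[of 0] psi_pos(1)[of p "0::'a"]
      by (meson abs_ge_zero order.trans zero_le_mult_iff linorder_not_less)
    \<comment> \<open>The growth of \<open>f\<close> is controlled by \<open>psi\<close>, which
      \<open>e_psi\<close> compensates, so the distant mass contributes nothing in the
      limit.\<close>
    have "\<bar>e n * f (z n)\<bar> \<le> C * inverse (real (Suc n))" for n
    proof -
      have "\<bar>e n * f (z n)\<bar> \<le> e n * (C * psi p (z n))"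
        using C e_pos by (simp add: abs_mult mult_left_mono)
      also have "\<dots> = C * (e n * psi p (z n))" by simp
      also have "\<dots> \<le> C * inverse (real (Suc n))" using e_psi \<open>C \<ge> 0\<close> by (rule mult_left_mono)
      finally show ?thesis .
    qed
    then have "(\<lambda>n. e n * f (z n)) \<longlonglongrightarrow> 0"
      by (intro Lim_null_comparison[OF _ tendsto_mult_right_zero[OF LIMSEQ_inverse_real_of_nat, of C]]
          always_eventually allI) (simp only: real_norm_def)
    then have "(\<lambda>n. e n * f (z n) + (1 - e n) * f 0) \<longlonglongrightarrow> 0 + (1 - 0) * f 0"
      by (intro tendsto_intros e0)
    then show "(\<lambda>n. integral\<^sup>L (mix (e n) (return borel (z n)) (return borel 0)) f)
        \<longlonglongrightarrow> integral\<^sup>L (return borel 0) f"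
      using f e_pos e_le by (simp add: integral_mix_Cb_psi integral_return_Cb_psi)
  qed (use e_pos e_le in \<open>auto intro: mix_in_P_psi\<close>)
  then have "(\<lambda>n. e n * u (z n) + (1 - e n) * u 0) \<longlonglongrightarrow> u 0"
    using e_pos e_le by (simp add: aff u_def)
  \<comment> \<open>Removing the contribution of the Dirac measure at 0 leaves
    \<open>e n * u (z n)\<close> tending to 0, although its absolute value is always 1.\<close>
  then have "(\<lambda>n. (e n * u (z n) + (1 - e n) * u 0) - (1 - e n) * u 0) \<longlonglongrightarrow> u 0 - (1 - 0) * u 0"
    by (intro tendsto_intros e0)
  then have "(\<lambda>n. \<bar>e n * u (z n)\<bar>) \<longlonglongrightarrow> 0" by (simp add: tendsto_rabs_zero)
  moreover have "\<bar>e n * u (z n)\<bar> = 1" for n using u_pos[of n] by (simp add: e_def abs_mult)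
  ultimately show False by (simp add: LIMSEQ_const_iff)
qed

lemma u_in_Cb_psi: "u \<in> Cb_psi (psi p)"
proof -
  obtain C where C: "\<And>z. \<bar>u z\<bar> \<le> C * psi p z" using u_growth by blast
  have "norm (u z / psi p z) \<le> C" for z
    using C[of z] psi_pos[of p z] by (simp add: abs_divide pos_divide_le_eq)
  then have "bounded (range (\<lambda>z. u z / psi p z))" unfolding bounded_iff by blast
  then show ?thesis using continuous_u by (simp add: Cb_psi_def)
qed

section \<open>Expected utility by finitely supported approximation\<close>

lemma finite_support_measure:
  assumes "finite S" "\<And>z. z \<in> S \<Longrightarrow> 0 \<le> w z" "sum w S = 1"
  shows "\<exists>N\<in>P_psi p. (\<forall>B\<in>sets borel. measure N B = (\<Sum>z\<in>S. w z * indicator B z)) \<and> U N = integral\<^sup>L N u"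
  using assms
proof (induction S arbitrary: w)
  case (insert z S)
  \<comment> \<open>One support point is split off and the other weights are divided by
    \<open>1 - w z\<close>, so that affinity of \<open>U\<close> applies. If \<open>w z = 1\<close>
    no rescaling is possible, but then the other weights vanish and a Dirac measure serves.\<close>
  show ?case
  proof (cases "w z = 1")
    case True
    then have "sum w S = 0" using insert by simp
    then have "\<forall>y\<in>S. w y = 0" using insert by (subst (asm) sum_nonneg_eq_0_iff) auto
    then have "(\<Sum>y\<in>insert z S. w y * indicator B y) = indicator B z" for B
      using True sum.insert[OF insert.hyps(1,2), of "\<lambda>y. w y * indicator B y"] by simp
    then show ?thesis
      by (intro bexI[of _ "return borel z"])
        (auto simp: measure_return u_def[symmetric] integral_return_Cb_psi[OF u_in_Cb_psi])
  next
    case False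
    have sum: "w z + sum w S = 1" using insert by simp
    moreover have "0 \<le> sum w S" using insert by (intro sum_nonneg) auto
    ultimately have wz: "0 \<le> w z" "w z < 1" using insert False by auto
    have "(\<Sum>y\<in>S. w y / (1 - w z)) = 1"
      using sum wz by (simp add: field_simps flip: sum_divide_distrib)
    then obtain N where N: "N \<in> P_psi p" "U N = integral\<^sup>L N u"
      and meas: "\<And>B. B \<in> sets borel \<Longrightarrow> measure N B = (\<Sum>y\<in>S. w y / (1 - w z) * indicator B y)"
      using insert.IH[of "\<lambda>y. w y / (1 - w z)"] insert.prems wz by auto
    show ?thesis
    proof (intro bexI[of _ "mix (w z) (return borel z) N"] conjI ballI)
      show "U (mix (w z) (return borel z) N) = integral\<^sup>L (mix (w z) (return borel z) N) u"
        using N wz by (simp add: aff integral_mix_Cb_psi[OF u_in_Cb_psi]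
            integral_return_Cb_psi[OF u_in_Cb_psi] u_def)
      fix B :: "'a set" assume B: "B \<in> sets borel"
      have "measure (mix (w z) (return borel z) N) B
          = w z * measure (return borel z) B + (1 - w z) * measure N B"
        using N(1) wz P_psiD by (intro measure_mix) (auto simp: prob_space_return)
      also have "\<dots> = w z * indicator B z + (\<Sum>y\<in>S. w y * indicator B y)"
        using B wz by (simp add: measure_return meas sum_distrib_left)
      finally show "measure (mix (w z) (return borel z) N) B = (\<Sum>y\<in>insert z S. w y * indicator B y)"
        using sum.insert[OF insert.hyps(1,2), of "\<lambda>y. w y * indicator B y"] by simp
    qed (use N wz in \<open>auto intro: mix_in_P_psi\<close>)
  qed
qed auto

text \<open>The pushforward charges the finitely many values of \<open>F\<close> with the masses of
  their fibres, so it coincides with a measure from \<open>finite_support_measure\<close>.\<close>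

lemma utility_distr_simple:
  assumes M: "M \<in> P_psi p" and F: "simple_function M F" and D: "distr M borel F \<in> P_psi p"
  shows "U (distr M borel F) = integral\<^sup>L (distr M borel F) u"
proof -
  interpret prob_space M using P_psiD(3)[OF M] .
  note sp = P_psiD(2)[OF M]
  have meas: "F \<in> borel_measurable M" using F by (rule borel_measurable_simple_function)
  have fin: "finite (range F)" using F sp by (simp add: simple_function_def)
  have sets: "F -` {z} \<in> sets M" for z using measurable_sets[OF meas, of "{z}"] sp by simp
  define w where "w z = measure M (F -` {z})" for z
  have preimage: "measure M (F -` B) = (\<Sum>z\<in>range F. w z * indicator B z)" for B
  proof -
    have "F -` B = (\<Union>z\<in>range F \<inter> B. F -` {z})" by auto
    moreover have "measure M (\<Union>z\<in>range F \<inter> B. F -` {z}) = (\<Sum>z\<in>range F \<inter> B. w z)"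
      unfolding w_def using fin sets
      by (intro finite_measure_finite_Union) (auto simp: disjoint_family_on_def)
    ultimately show ?thesis
      using fin by (simp add: indicator_def sum.inter_restrict if_distrib cong: if_cong)
  qed
  have "sum w (range F) = 1" using preimage[of UNIV] prob_space sp by simp
  then obtain N where N: "N \<in> P_psi p" "U N = integral\<^sup>L N u"
    and Nm: "\<And>B. B \<in> sets borel \<Longrightarrow> measure N B = (\<Sum>z\<in>range F. w z * indicator B z)"
    using finite_support_measure[OF fin, of w] by (auto simp: w_def)
  have "distr M borel F = N"
  proof (rule prob_measure_eqI)
    fix B
    show "measure (distr M borel F) B = measure N B"
    proof (cases "B \<in> sets borel")
      case True
      then show ?thesis using meas sp by (simp add: measure_distr preimage Nm)
    next
      case False
      then show ?thesis using P_psiD(1)[OF N(1)] by (simp add: measure_notin_sets)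
    qed
  qed (use P_psiD[OF N(1)] P_psiD[OF D] in auto)
  then show ?thesis using N by simp
qed

text \<open>Both \<open>U\<close> and integration of \<open>u\<close> pass to the limit along the
  approximating pushforwards, the latter because \<open>u\<close> is itself a test function.\<close>

lemma utility_eq_integral:
  assumes M: "M \<in> P_psi p"
  shows "U M = integral\<^sup>L M u"
proof -
  note sM = P_psiD[OF M]
  note [measurable_cong] = sM(1)
  interpret prob_space M by fact
  have "(\<lambda>z. z) \<in> borel_measurable M" by measurable
  \<comment> \<open>The base point 0 yields the bound \<open>2 * norm x\<close>, which keeps the
    pushforwards in \<open>P_psi p\<close> and supplies the dominating function.\<close>
  from borel_measurable_implies_sequence_metric[OF this, of 0] obtain F where
    F: "\<And>i. simple_function M (F i)" "\<And>x. (\<lambda>i. F i x) \<longlonglongrightarrow> x" "\<And>i x. norm (F i x) \<le> 2 * norm x"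
    using sM(2) by auto
  have [measurable]: "F i \<in> borel_measurable M" for i using F(1) by (rule borel_measurable_simple_function)
  define X where "X i = distr M borel (F i)" for i
  have X: "X i \<in> P_psi p" for i
    unfolding X_def using p_ge_1 F(3) by (intro distr_in_P_psi[OF M]) auto
  have conv: "(\<lambda>n. integral\<^sup>L (X n) f) \<longlonglongrightarrow> integral\<^sup>L M f" if f: "f \<in> Cb_psi (psi p)" for f
  proof -
    obtain C where C: "\<And>z. \<bar>f z\<bar> \<le> C * psi p z" using Cb_psi_bound[OF f] by blast
    have [measurable]: "f \<in> borel_measurable borel" using Cb_psi_measurable[OF f] .
    have bound: "\<bar>f (F i x)\<bar> \<le> \<bar>C\<bar> * (1 + 2 powr p * norm x powr p)" for i x
    proof -
      have "norm (F i x) powr p \<le> (2 * norm x) powr p" using p_ge_1 F(3) by (intro powr_mono2) auto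
      then have "psi p (F i x) \<le> 1 + 2 powr p * norm x powr p" by (simp add: psi_def powr_mult)
      then have "\<bar>C\<bar> * psi p (F i x) \<le> \<bar>C\<bar> * (1 + 2 powr p * norm x powr p)"
        by (intro mult_left_mono) auto
      moreover have "C * psi p (F i x) \<le> \<bar>C\<bar> * psi p (F i x)"
        using psi_pos(1)[of p "F i x"] by (intro mult_right_mono) auto
      ultimately show ?thesis using C[of "F i x"] by linarith
    qed
    have "(\<lambda>i. \<integral>x. f (F i x) \<partial>M) \<longlonglongrightarrow> integral\<^sup>L M f"
    proof (rule integral_dominated_convergence[where w="\<lambda>x. \<bar>C\<bar> * (1 + 2 powr p * norm x powr p)"])
      have "isCont f x" for x using f by (simp add: Cb_psi_def continuous_on_eq_continuous_at)
      then show "AE x in M. (\<lambda>i. f (F i x)) \<longlonglongrightarrow> f x"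
        using F(2) by (intro AE_I2 isCont_tendsto_compose[where g=f])
    qed (use bound sM(4) in auto)
    then show ?thesis by (simp add: X_def integral_distr)
  qed
  have "(\<lambda>n. U (X n)) \<longlonglongrightarrow> U M" using utility_tendsto[OF X M conv] .
  moreover have "U (X n) = integral\<^sup>L (X n) u" for n
    using utility_distr_simple[OF M F(1)] X by (simp add: X_def)
  ultimately show ?thesis using conv[OF u_in_Cb_psi] LIMSEQ_unique by auto
qed

text \<open>The conditional expectation of the lottery \<open>t \<delta>\<^sub>x + (1 - t) \<delta>\<^sub>y\<close> given the trivial
  \<open>\<sigma>\<close>-algebra is the constant \<open>t x + (1 - t) y\<close>.\<close>

lemma concave_u:
  assumes "risk_averse p R"
  shows "concave_on UNIV u"
  unfolding concave_on_iff
proof (intro conjI ballI allI impI)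
  fix x y :: 'a and t s :: real assume ts: "0 \<le> t" "0 \<le> s" "t + s = 1"
  define M where "M = mix t (return borel x) (return borel y)"
  define c where "c = t *\<^sub>R x + s *\<^sub>R y"
  have s: "s = 1 - t" using ts by simp
  have M: "M \<in> P_psi p" unfolding M_def using ts by (intro mix_in_P_psi) auto
  interpret prob_space M using P_psiD(3)[OF M] .
  have int_id: "integrable (return borel z) (\<lambda>z. z)" for z :: 'a
    by (auto simp: integrable_iff_bounded nn_integral_return)
  have "integral\<^sup>L M (\<lambda>z. z) = c"
    unfolding M_def c_def s using ts
    by (subst integral_mix) (auto simp: integral_return prob_space_return int_id)
  then have "is_cond_exp M {{}, UNIV} (\<lambda>_. c)"
    using P_psiD(2)[OF M] prob_space by (auto simp: is_cond_exp_def set_lebesgue_integral_def)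
  moreover have "sigma_algebra UNIV {{}, UNIV :: 'a set}" by (rule sigma_algebra_trivial)
  ultimately have "R (distr M borel (\<lambda>_. c)) M"
    using assms M unfolding risk_averse_def by (metis (no_types, lifting) empty_subsetI insert_subset sets.empty_sets sets.top space_borel)
  moreover have "distr M borel (\<lambda>_. c) = return borel c"
    by (rule distr_const) simp
  ultimately have "U M \<le> u c" using M by (simp add: R_iff u_def)
  moreover have "U M = t * u x + s * u y" unfolding M_def u_def s using ts by (simp add: aff)
  ultimately show "u (t *\<^sub>R x + s *\<^sub>R y) \<ge> t * u x + s * u y" by (simp add: c_def)
qed simp

end

section \<open>Assembly of the representation\<close>

theorem mainTheorem7:
  fixes p :: real
    and R :: "'a::{banach_lattice, second_countable_topology} measure \<Rightarrow> 'a measure \<Rightarrow> bool"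
  assumes "p \<ge> 1"
    and "total_preorder_on (P_psi p) R"
    and "pref_continuous p R"
    and "risk_averse p R"
    and "independence_axiom p R"
  shows "\<exists>u. concave_on UNIV u \<and> u \<in> Cb_psi (psi p) \<and>
           (\<forall>\<mu>\<in>P_psi p. \<forall>\<nu>\<in>P_psi p.
              strict R \<mu> \<nu> \<longleftrightarrow> integral\<^sup>L \<mu> u > integral\<^sup>L \<nu> u)"
proof -
  interpret mixture_preference "P_psi p" mix "\<lambda>B M. measure M B" R
    using assms by (intro preference_mixture_preference)
  obtain U where "\<forall>M\<in>P_psi p. \<forall>N\<in>P_psi p. strict R M N \<longleftrightarrow> U M > U N"
    and "\<forall>M\<in>P_psi p. \<forall>N\<in>P_psi p. \<forall>t\<in>{0..1}. U (mix t M N) = t * U M + (1 - t) * (U N :: real)"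
    using affine_utility_exists by blast
  then interpret U: affine_utility p R U
    using assms by unfold_locales auto
  show ?thesis
    using U.concave_u[OF assms(4)] U.u_in_Cb_psi U.repr U.utility_eq_integral by auto
qed

end
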